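(* Let $d\in\mathbb{N}$ and $1<p\leq q<\infty$. For all $x\in\ell^p_q(\mathbb{Z}^d)$ we have $Mx\in\ell^p_q(\mathbb{Z}^d)$, and there exists $C>0$ such that $\|Mx\|_{\ell^p_q(\mathbb{Z}^d)}\leq C\|x\|_{\ell^p_q(\mathbb{Z}^d)}$ holds for all $x\in\ell^p_q(\mathbb{Z}^d)$.
   Context: $\mathbb{N}=\{1,2,3,\dots\}$ and $\omega:=\mathbb{N}\cup\{0\}$. $\|(x_1,\dots,x_d)\|_\infty:=\max\{|x_i|:1\le i\le d\}$, and $|S|$ denotes the cardinality of a set $S$. For $m\in\mathbb{Z}^d$ and $N\in\omega$ let $S_{m,N}:=\{k\in\mathbb{Z}^d:\|k-m\|_\infty\leq N\}$, so $|S_{m,N}|=(2N+1)^d$. For $1\leq p\leq q<\infty$ the discrete Morrey space $\ell^p_q(\mathbb{Z}^d)$ is the space of all functions $x\colon\mathbb{Z}^d\to\mathbb{R}$ for which $$\|x\|_{\ell^p_q(\mathbb{Z}^d)}:=\sup_{m\in\mathbb{Z}^d,\,N\in\omega}|S_{m,N}|^{\frac1q-\frac1p}\Bigl(\sum_{k\in S_{m,N}}|x(k)|^p\Bigr)^{1/p}<\infty.$$ The discrete Hardy-Littlewood maximal operator $M$ is defined by $Mx(m):=\sup_{N\in\omega}\frac{1}{|S_{m,N}|}\sum_{k\in S_{m,N}}|x(k)|$ for $x\in\mathbb{R}^{\mathbb{Z}^d}$ and $m\in\mathbb{Z}^d$. *)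

theory Defs
  imports "HOL-Analysis.Analysis"
begin

text \<open>
  The lattice of dimension \<open>d\<close> is the type \<open>int ^ 'd\<close>, where \<open>CARD('d)\<close> plays the role of \<open>d\<close>;
  types are nonempty, so \<open>d \<ge> 1\<close> always holds. The index set of natural numbers including \<open>0\<close> is
  the type \<open>nat\<close>.
\<close>

definition sup_norm :: "int ^ 'd \<Rightarrow> int"
  where "sup_norm k = Max (range (\<lambda>i. \<bar>k $ i\<bar>))"

definition lattice_cube :: "int ^ 'd \<Rightarrow> nat \<Rightarrow> (int ^ 'd) set"
  where "lattice_cube m N = {k. sup_norm (k - m) \<le> int N}"

text \<open>
  Suprema are taken in \<^typ>\<open>ennreal\<close>, so that they are meaningful also when infinite. In particular
  the maximal function of an arbitrary real function may take the value \<open>\<infinity>\<close>.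
\<close>

definition morrey_norm :: "real \<Rightarrow> real \<Rightarrow> (int ^ 'd \<Rightarrow> real) \<Rightarrow> ennreal"
  where "morrey_norm p q x =
    (SUP (m, N) \<in> UNIV. ennreal (real (card (lattice_cube m N)) powr (1 / q - 1 / p) *
      (\<Sum>k\<in>lattice_cube m N. \<bar>x k\<bar> powr p) powr (1 / p)))"

definition morrey_space :: "real \<Rightarrow> real \<Rightarrow> (int ^ 'd \<Rightarrow> real) set"
  where "morrey_space p q = {x. morrey_norm p q x < \<infinity>}"

definition maximal_function :: "(int ^ 'd \<Rightarrow> real) \<Rightarrow> int ^ 'd \<Rightarrow> ennreal"
  where "maximal_function x m =
    (SUP N. ennreal (1 / real (card (lattice_cube m N)) * (\<Sum>k\<in>lattice_cube m N. \<bar>x k\<bar>)))"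

lemma sup_norm_le_iff: "sup_norm k \<le> c \<longleftrightarrow> (\<forall>i. \<bar>k $ i\<bar> \<le> c)"
  unfolding sup_norm_def by (subst Max_le_iff) auto

text \<open>
  The cubes are finite, so the cardinalities and finite sums above carry their usual meaning.
\<close>

lemma lattice_cube_bij:
  "bij_betw vec_lambda (PiE UNIV (\<lambda>i. {m $ i - int N .. m $ i + int N})) (lattice_cube m N)"
proof (rule bij_betwI[where g = vec_nth])
  have iff: "vec_lambda f \<in> lattice_cube m N \<longleftrightarrow> (\<forall>i. f i \<in> {m $ i - int N .. m $ i + int N})" for f
    unfolding lattice_cube_def mem_Collect_eq sup_norm_le_iff
    by (intro iff_allI) (simp, arith)
  show "vec_lambda \<in> (PiE UNIV (\<lambda>i. {m $ i - int N .. m $ i + int N})) \<rightarrow> lattice_cube m N"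
    unfolding Pi_iff PiE_iff iff by blast
  show "vec_nth \<in> lattice_cube m N \<rightarrow> (PiE UNIV (\<lambda>i. {m $ i - int N .. m $ i + int N}))"
  proof
    fix k assume "k \<in> lattice_cube m N"
    then have "vec_lambda (vec_nth k) \<in> lattice_cube m N" by simp
    then show "vec_nth k \<in> (PiE UNIV (\<lambda>i. {m $ i - int N .. m $ i + int N}))"
      unfolding PiE_iff iff by simp
  qed
qed (simp_all add: fun_eq_iff)

lemma finite_lattice_cube: "finite (lattice_cube m N)"
  using bij_betw_finite[OF lattice_cube_bij[of m N]] by (simp add: finite_PiE)

lemma card_lattice_cube: "card (lattice_cube (m :: int ^ 'd) N) = (2 * N + 1) ^ CARD('d)"
proof -
  have "nat (1 + 2 * int N) = Suc (2 * N)" by linarith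
  then show ?thesis
    using bij_betw_same_card[OF lattice_cube_bij[of m N]] by (simp add: card_PiE algebra_simps)
qed

end

theory Submission
  imports Defs
begin

text \<open>
  For a linearised maximal operator, in which a radius has been chosen at every point, a finite
  Vitali covering argument gives a weak type estimate against the part of the function above half
  the level, and integrating over the levels gives the strong type estimate on $\ell^p$.
  For the Morrey norm over a cube of radius \<open>N\<close>, averages with radius at most \<open>N\<close> only see the cube
  of radius \<open>2 * N\<close>, where the $\ell^p$ estimate applies; averages with a larger radius are bounded
  by the power mean inequality and the Morrey norm.
\<close>

section \<open>Geometry of lattice cubes\<close>

lemma mem_lattice_cube_iff: "k \<in> lattice_cube m N \<longleftrightarrow> (\<forall>i. \<bar>k $ i - m $ i\<bar> \<le> int N)"
  by (simp add: lattice_cube_def sup_norm_le_iff)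

lemma lattice_cube_mono: "M \<le> N \<Longrightarrow> lattice_cube m M \<subseteq> lattice_cube m N"
  unfolding mem_lattice_cube_iff subset_iff by (meson of_nat_mono order_trans)

lemma lattice_cube_trans:
  assumes "k \<in> lattice_cube m N" and "j \<in> lattice_cube k M"
  shows "j \<in> lattice_cube m (N + M)"
  unfolding mem_lattice_cube_iff
proof
  fix i
  have "\<bar>k $ i - m $ i\<bar> \<le> int N" "\<bar>j $ i - k $ i\<bar> \<le> int M"
    using assms by (simp_all add: mem_lattice_cube_iff)
  then show "\<bar>j $ i - m $ i\<bar> \<le> int (N + M)" by linarith
qed

lemma lattice_cube_sym: "k \<in> lattice_cube m N \<longleftrightarrow> m \<in> lattice_cube k N"
  by (simp add: mem_lattice_cube_iff abs_minus_commute)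

lemma card_lattice_cube_pos: "0 < card (lattice_cube m N)"
  by (simp add: card_lattice_cube)

lemma card_lattice_cube_double:
  "card (lattice_cube (m :: int ^ 'd) (2 * N)) \<le> 2 ^ CARD('d) * card (lattice_cube m N)"
proof -
  have "(2 * (2 * N) + 1) ^ CARD('d) \<le> (2 * (2 * N + 1)) ^ CARD('d)"
    by (intro power_mono) auto
  then show ?thesis unfolding card_lattice_cube by (simp only: power_mult_distrib)
qed

section \<open>Cube averages, the Vitali covering argument and the weak type estimate\<close>

definition cube_avg :: "(int ^ 'd \<Rightarrow> real) \<Rightarrow> int ^ 'd \<Rightarrow> nat \<Rightarrow> real"
  where "cube_avg f m N = (\<Sum>k\<in>lattice_cube m N. f k) / real (card (lattice_cube m N))"

lemma cube_avg_nonneg: "(\<And>k. 0 \<le> f k) \<Longrightarrow> 0 \<le> cube_avg f m N"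
  by (simp add: cube_avg_def sum_nonneg)

lemma maximal_function_eq_SUP_cube_avg:
  "maximal_function x m = (SUP N. ennreal (cube_avg (\<lambda>k. \<bar>x k\<bar>) m N))"
  by (simp add: maximal_function_def cube_avg_def)

text \<open>Greedy Vitali selection: the cubes that meet a cube of largest radius have their centres
  in its double, and the other cubes are disjoint from it and handled by induction. Only centres
  have to be covered, so doubling the radius suffices instead of tripling it; this gives the factor
  \<open>2 ^ CARD('d)\<close>.\<close>

lemma card_le_sum_Union_cubes:
  fixes r :: "int ^ 'd \<Rightarrow> nat" and w :: "int ^ 'd \<Rightarrow> real"
  assumes "finite E" and w: "\<And>k. 0 \<le> w k"
    and "\<And>k. k \<in> E \<Longrightarrow> real (card (lattice_cube k (r k))) \<le> sum w (lattice_cube k (r k))"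
  shows "real (card E) \<le> 2 ^ CARD('d) * sum w (\<Union>k\<in>E. lattice_cube k (r k))"
  using assms(1,3)
proof (induction E rule: finite_psubset_induct)
  case (psubset E)
  show ?case
  proof (cases "E = {}")
    case False
    let ?S = "\<lambda>k. lattice_cube k (r k)"
    obtain k where k: "k \<in> E" and r: "\<And>j. j \<in> E \<Longrightarrow> r j \<le> r k"
    proof -
      have "Max (r ` E) \<in> r ` E" using psubset.hyps False by (intro Max_in) auto
      then obtain k where "k \<in> E" "Max (r ` E) = r k" by blast
      then show thesis using that[of k] psubset.hyps by (metis Max_ge finite_imageI imageI)
    qed
    define E' where "E' = {j \<in> E. ?S j \<inter> ?S k = {}}"
    \<comment> \<open>The cube of \<open>k\<close> meets itself, so \<open>k\<close> drops out of
      \<open>E'\<close> and the induction hypothesis applies.\<close>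
    have "k \<in> ?S k" by (simp add: mem_lattice_cube_iff)
    then have "E' \<subset> E" using k by (auto simp: E'_def)
    then have IH: "real (card E') \<le> 2 ^ CARD('d) * sum w (\<Union>j\<in>E'. ?S j)"
      using psubset.prems by (intro psubset.IH) auto
    have finE': "finite E'" using \<open>E' \<subset> E\<close> psubset.hyps finite_subset by blast
    have "E \<subseteq> E' \<union> lattice_cube k (2 * r k)"
    proof
      fix j assume j: "j \<in> E"
      show "j \<in> E' \<union> lattice_cube k (2 * r k)"
      proof (cases "?S j \<inter> ?S k = {}")
        case False
        then obtain i where i: "i \<in> ?S j" "i \<in> ?S k" by blast
        then have "j \<in> lattice_cube i (r j)" using lattice_cube_sym by blast
        then have "j \<in> lattice_cube k (r k + r j)" using lattice_cube_trans i(2) by blast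
        then show ?thesis using lattice_cube_mono[of "r k + r j" "2 * r k" k] r[OF j] by auto
      qed (simp add: E'_def j)
    qed
    then have "card E \<le> card (E' \<union> lattice_cube k (2 * r k))"
      by (intro card_mono) (simp_all add: finE' finite_lattice_cube)
    also have "\<dots> \<le> card E' + card (lattice_cube k (2 * r k))" by (rule card_Un_le)
    also have "\<dots> \<le> card E' + 2 ^ CARD('d) * card (?S k)"
      using card_lattice_cube_double[of k "r k"] by simp
    finally have "real (card E) \<le> real (card E' + 2 ^ CARD('d) * card (?S k))"
      by (rule of_nat_mono)
    also have "\<dots> = real (card E') + 2 ^ CARD('d) * real (card (?S k))" by simp
    also have "\<dots> \<le> 2 ^ CARD('d) * sum w (\<Union>j\<in>E'. ?S j) + 2 ^ CARD('d) * sum w (?S k)"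
      using IH psubset.prems[OF k] by (intro add_mono mult_left_mono) auto
    \<comment> \<open>By the choice of \<open>E'\<close> the two sets are disjoint, so no mass of
      \<open>w\<close> is counted twice.\<close>
    also have "\<dots> = 2 ^ CARD('d) * sum w ((\<Union>j\<in>E'. ?S j) \<union> ?S k)"
      by (subst sum.union_disjoint)
        (auto simp: E'_def finite_lattice_cube psubset.hyps distrib_left)
    also have "\<dots> \<le> 2 ^ CARD('d) * sum w (\<Union>j\<in>E. ?S j)"
      using k w by (intro mult_left_mono sum_mono2)
        (auto simp: E'_def finite_lattice_cube psubset.hyps)
    finally show ?thesis .
  qed simp
qed

text \<open>Values of \<open>f\<close> below \<open>t / 2\<close> contribute less than
  \<open>t / 2\<close> to an average, so an average of at least \<open>t\<close> draws at least
  \<open>t / 2\<close> from the large values. Scaled by \<open>2 / t\<close>, the large part becomes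
  a weight \<open>w\<close> to which the covering lemma applies. Keeping only the large values
  bounds the range of levels that each \<open>f j\<close> contributes to.\<close>

lemma cube_avg_weak_type:
  fixes r :: "int ^ 'd \<Rightarrow> nat" and f :: "int ^ 'd \<Rightarrow> real"
  assumes "finite F" and "finite B" and B: "\<And>k. k \<in> F \<Longrightarrow> lattice_cube k (r k) \<subseteq> B"
    and f: "\<And>k. 0 \<le> f k" and t: "0 < t"
  shows "t * real (card {k \<in> F. t \<le> cube_avg f k (r k)})
    \<le> 2 ^ Suc CARD('d) * (\<Sum>j | j \<in> B \<and> t \<le> 2 * f j. f j)"
proof -
  define w where "w j = 2 / t * (if t \<le> 2 * f j then f j else 0)" for j
  define E where "E = {k \<in> F. t \<le> cube_avg f k (r k)}"
  have w: "0 \<le> w j" for j using f t by (simp add: w_def)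
  have "finite E" using assms(1) by (simp add: E_def)
  have *: "real (card (lattice_cube k (r k))) \<le> sum w (lattice_cube k (r k))" if "k \<in> E" for k
  proof -
    let ?S = "lattice_cube k (r k)"
    have "t * real (card ?S) \<le> sum f ?S"
      using that card_lattice_cube_pos[of k "r k"] by (simp add: E_def cube_avg_def field_simps)
    also have "\<dots> \<le> (\<Sum>j\<in>?S. t / 2 * w j + t / 2)"
      using t f by (intro sum_mono) (auto simp: w_def)
    also have "\<dots> = t / 2 * sum w ?S + t / 2 * real (card ?S)"
      by (simp add: sum.distrib sum_distrib_left)
    finally have "t / 2 * real (card ?S) \<le> t / 2 * sum w ?S" by linarith
    then show ?thesis using t by (simp add: mult_le_cancel_left)
  qed
  have "real (card E) \<le> 2 ^ CARD('d) * sum w (\<Union>k\<in>E. lattice_cube k (r k))"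
    by (rule card_le_sum_Union_cubes[OF \<open>finite E\<close> w *])
  also have "\<dots> \<le> 2 ^ CARD('d) * sum w B"
    using B w by (intro mult_left_mono sum_mono2 assms) (auto simp: E_def)
  also have "sum w B = 2 / t * (\<Sum>j | j \<in> B \<and> t \<le> 2 * f j. f j)"
    unfolding w_def sum_distrib_left[symmetric]
    by (simp add: sum.inter_filter[OF assms(2)])
  finally show ?thesis using t by (simp add: E_def field_simps)
qed

section \<open>From the weak type to the strong type estimate by integration over levels\<close>

lemma has_integral_powr_up_to:
  fixes c a :: real
  assumes "0 < a" and "0 \<le> c"
  shows "((\<lambda>t. if 0 \<le> t \<and> t \<le> c then t powr (a - 1) else 0) has_integral c powr a / a) UNIV"
proof -
  have "((\<lambda>t. if t \<in> {0..c} then t powr (a - 1) else 0) has_integral c powr a / a) UNIV"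
    using has_integral_powr_from_0[of "a - 1" c] assms by (subst has_integral_restrict_UNIV) simp
  then show ?thesis by (simp only: atLeastAtMost_iff)
qed

text \<open>Multiply the weak type bound by \<open>t powr (p - 2)\<close> and integrate over
  \<open>t\<close>. The left side gives the p-th powers of the averages divided by \<open>p\<close>;
  on the right each \<open>f j\<close> is integrated over levels up to \<open>2 * f j\<close>.
  Integrability there at \<open>t = 0\<close> requires \<open>p > 1\<close> and produces the factor
  \<open>1 / (p - 1)\<close>.\<close>

lemma cube_avg_strong_type:
  fixes r :: "int ^ 'd \<Rightarrow> nat" and f :: "int ^ 'd \<Rightarrow> real"
  assumes "finite F" and "finite B" and B: "\<And>k. k \<in> F \<Longrightarrow> lattice_cube k (r k) \<subseteq> B"
    and f: "\<And>k. 0 \<le> f k" and p: "1 < p"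
  shows "(\<Sum>k\<in>F. cube_avg f k (r k) powr p)
    \<le> 2 ^ CARD('d) * 2 powr p * p / (p - 1) * (\<Sum>j\<in>B. f j powr p)"
proof -
  let ?g = "\<lambda>k. cube_avg f k (r k)"
  let ?D = "2 ^ Suc CARD('d) :: real"
  let ?h = "\<lambda>a c t :: real. if 0 \<le> t \<and> t \<le> c then t powr (a - 1) else 0"
  have "((\<lambda>t. \<Sum>k\<in>F. ?h p (?g k) t) has_integral (\<Sum>k\<in>F. ?g k powr p / p)) UNIV"
    using p f assms(1) by (intro has_integral_sum has_integral_powr_up_to cube_avg_nonneg) auto
  moreover have "((\<lambda>t. ?D * (\<Sum>j\<in>B. f j * ?h (p - 1) (2 * f j) t)) has_integral
      ?D * (\<Sum>j\<in>B. f j * ((2 * f j) powr (p - 1) / (p - 1)))) UNIV"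
    using p f assms(2)
    by (intro has_integral_mult_right has_integral_sum has_integral_powr_up_to) auto
  moreover have "(\<Sum>k\<in>F. ?h p (?g k) t) \<le> ?D * (\<Sum>j\<in>B. f j * ?h (p - 1) (2 * f j) t)" for t
  proof (cases "0 < t")
    case True
    have "(\<Sum>k\<in>F. ?h p (?g k) t) = (\<Sum>k\<in>F. if t \<le> ?g k then t powr (p - 1) else 0)"
      using True by (intro sum.cong) auto
    also have "\<dots> = t powr (p - 1) * real (card {k \<in> F. t \<le> ?g k})"
      by (simp add: sum.inter_filter[OF assms(1), symmetric])
    \<comment> \<open>One power of \<open>t\<close> is split off to match the left side of the weak
      type estimate.\<close>
    also have "\<dots> = t powr (p - 2) * (t * real (card {k \<in> F. t \<le> ?g k}))"
      using True powr_add[of t "p - 2" 1] by simp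
    also have "\<dots> \<le> t powr (p - 2) * (?D * (\<Sum>j | j \<in> B \<and> t \<le> 2 * f j. f j))"
      by (intro mult_left_mono cube_avg_weak_type assms True) auto
    also have "\<dots> = ?D * (\<Sum>j\<in>B. t powr (p - 2) * (if t \<le> 2 * f j then f j else 0))"
      by (simp add: sum.inter_filter[OF assms(2)] sum_distrib_left[symmetric])
    also have "(\<Sum>j\<in>B. t powr (p - 2) * (if t \<le> 2 * f j then f j else 0))
        = (\<Sum>j\<in>B. f j * ?h (p - 1) (2 * f j) t)"
      using True by (intro sum.cong) (auto simp: diff_diff_eq)
    finally show ?thesis .
  next
    case False
    \<comment> \<open>At \<open>t = 0\<close> the cut-off does not help, but
      \<open>0 powr (p - 1)\<close> is \<open>0\<close>.\<close>
    then have "(\<Sum>k\<in>F. ?h p (?g k) t) = 0"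
      by (intro sum.neutral) auto
    moreover have "0 \<le> (\<Sum>j\<in>B. f j * ?h (p - 1) (2 * f j) t)"
      using f by (intro sum_nonneg mult_nonneg_nonneg) auto
    ultimately show ?thesis by simp
  qed
  ultimately have "(\<Sum>k\<in>F. ?g k powr p / p) \<le> ?D * (\<Sum>j\<in>B. f j * ((2 * f j) powr (p - 1) / (p - 1)))"
    by (rule has_integral_le)
  also have "(\<Sum>j\<in>B. f j * ((2 * f j) powr (p - 1) / (p - 1)))
      = (\<Sum>j\<in>B. 2 powr p / 2 / (p - 1) * f j powr p)"
  proof (rule sum.cong[OF refl])
    fix j
    have "f j * f j powr (p - 1) = f j powr p"
      using powr_mult_base[OF f[of j], of "p - 1"] by simp
    moreover have "2 * (2 :: real) powr (p - 1) = 2 powr p"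
      using powr_mult_base[of "2 :: real" "p - 1"] by simp
    moreover have "f j * ((2 * f j) powr (p - 1) / (p - 1))
        = 2 * 2 powr (p - 1) / 2 / (p - 1) * (f j * f j powr (p - 1))"
      using f[of j] by (simp add: powr_mult)
    ultimately show "f j * ((2 * f j) powr (p - 1) / (p - 1)) = 2 powr p / 2 / (p - 1) * f j powr p"
      by (simp only:)
  qed
  also have "\<dots> = 2 powr p / 2 / (p - 1) * (\<Sum>j\<in>B. f j powr p)"
    by (simp add: sum_distrib_left)
  also have "?D * (2 powr p / 2 / (p - 1) * (\<Sum>j\<in>B. f j powr p))
      = 2 ^ CARD('d) * 2 powr p / (p - 1) * (\<Sum>j\<in>B. f j powr p)"
    using p by (simp add: field_simps)
  finally have "(\<Sum>k\<in>F. ?g k powr p) / p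
      \<le> 2 ^ CARD('d) * 2 powr p / (p - 1) * (\<Sum>j\<in>B. f j powr p)"
    by (simp add: sum_divide_distrib)
  then have "(\<Sum>k\<in>F. ?g k powr p) \<le> 2 ^ CARD('d) * 2 powr p / (p - 1) * (\<Sum>j\<in>B. f j powr p) * p"
    using p by (simp add: pos_divide_le_eq)
  then show ?thesis by (simp add: mult_ac)
qed

section \<open>The power mean inequality and the size of averages under a Morrey bound\<close>

lemma sum_powr_le_card_powr:
  fixes f :: "'a \<Rightarrow> real"
  assumes "finite S" and f: "\<And>k. k \<in> S \<Longrightarrow> 0 \<le> f k" and p: "1 \<le> p"
  shows "(\<Sum>k\<in>S. f k) powr p \<le> real (card S) powr (p - 1) * (\<Sum>k\<in>S. f k powr p)"
proof -
  \<comment> \<open>Convexity of \<^term>\<open>\<lambda>t :: real. t powr p\<close> is only available on the positive half-line.\<close>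
  define T where "T = {k \<in> S. 0 < f k}"
  have T: "finite T" "T \<subseteq> S" using assms(1) by (auto simp: T_def)
  have z: "f k = 0" if "k \<in> S - T" for k using that f[of k] by (auto simp: T_def)
  have sums: "(\<Sum>k\<in>S. g (f k)) = (\<Sum>k\<in>T. g (f k))" if "g 0 = 0" for g :: "real \<Rightarrow> real"
    using T z that assms(1) by (intro sum.mono_neutral_right) auto
  note sums = sums[of "\<lambda>t. t", simplified] sums[of "\<lambda>t. t powr p", simplified]
  show ?thesis
  proof (cases "T = {}")
    case False
    define n where "n = real (card T)"
    have n: "0 < n" using False T by (simp add: n_def card_gt_0_iff)
    have "(\<Sum>k\<in>T. (1 / n) *\<^sub>R f k) powr p \<le> (\<Sum>k\<in>T. 1 / n * f k powr p)"
      using n by (intro convex_on_sum[OF T(1) False powr_convex[OF p]]) (auto simp: T_def n_def)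
    then have "(sum f T / n) powr p \<le> (\<Sum>k\<in>T. f k powr p) / n"
      by (simp add: sum_divide_distrib[symmetric])
    moreover have "(sum f T / n) powr p = sum f T powr p / n powr p"
      by (rule powr_divide)
    ultimately have "sum f T powr p \<le> n powr p / n * (\<Sum>k\<in>T. f k powr p)"
      using n by (simp add: field_simps)
    also have "n powr p / n = n powr (p - 1)" using n by (simp add: powr_diff)
    \<comment> \<open>Passing from the support back to \<open>S\<close> only enlarges the
      cardinality, and the exponent \<open>p - 1\<close> is nonnegative.\<close>
    also have "n powr (p - 1) * (\<Sum>k\<in>T. f k powr p) \<le> real (card S) powr (p - 1) * (\<Sum>k\<in>T. f k powr p)"
      using p n T assms(1) by (intro mult_right_mono powr_mono2 sum_nonneg) (auto simp: n_def card_mono)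
    finally show ?thesis by (simp add: sums)
  qed (simp add: sums)
qed

text \<open>This is one term of the supremum, solved for the l^p sum. A real bound \<open>K\<close>
  in place of the norm keeps the later computations out of \<open>ennreal\<close>.\<close>

lemma sum_cube_powr_le:
  fixes x :: "int ^ 'd \<Rightarrow> real"
  assumes "morrey_norm p q x \<le> ennreal K" and "0 \<le> K" and p: "0 < p"
  shows "(\<Sum>k\<in>lattice_cube m N. \<bar>x k\<bar> powr p)
    \<le> real (card (lattice_cube m N)) powr (1 - p / q) * K powr p"
proof -
  let ?V = "real (card (lattice_cube m N))"
  let ?s = "\<Sum>k\<in>lattice_cube m N. \<bar>x k\<bar> powr p"
  have V: "0 < ?V" using card_lattice_cube_pos[of m N] by simp
  have s: "0 \<le> ?s" by (simp add: sum_nonneg)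
  have "ennreal (?V powr (1 / q - 1 / p) * ?s powr (1 / p)) \<le> morrey_norm p q x"
    unfolding morrey_norm_def by (rule SUP_upper2[of "(m, N)"]) auto
  also note assms(1)
  finally have "?V powr (1 / q - 1 / p) * ?s powr (1 / p) \<le> K"
    using assms(2) by (simp add: ennreal_le_iff)
  then have "(?V powr (1 / q - 1 / p) * ?s powr (1 / p)) powr p \<le> K powr p"
    using p by (intro powr_mono2) auto
  then have "?V powr (p / q - 1) * ?s \<le> K powr p"
    using p s by (simp add: powr_mult powr_powr left_diff_distrib)
  then have "?V powr (1 - p / q) * (?V powr (p / q - 1) * ?s) \<le> ?V powr (1 - p / q) * K powr p"
    by (intro mult_left_mono) auto
  moreover have "?V powr (1 - p / q) * ?V powr (p / q - 1) = 1"
    using V by (simp add: powr_add[symmetric])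
  ultimately show ?thesis by (simp add: mult.assoc[symmetric])
qed

lemma cube_avg_le_morrey:
  fixes x :: "int ^ 'd \<Rightarrow> real"
  assumes "morrey_norm p q x \<le> ennreal K" and "0 \<le> K" and p: "1 \<le> p"
  shows "cube_avg (\<lambda>k. \<bar>x k\<bar>) m N \<le> real (card (lattice_cube m N)) powr (- 1 / q) * K"
proof -
  let ?V = "real (card (lattice_cube m N))"
  let ?s = "\<Sum>k\<in>lattice_cube m N. \<bar>x k\<bar>"
  have V: "0 < ?V" using card_lattice_cube_pos[of m N] by simp
  have "?s powr p \<le> ?V powr (p - 1) * (\<Sum>k\<in>lattice_cube m N. \<bar>x k\<bar> powr p)"
    using p by (intro sum_powr_le_card_powr finite_lattice_cube) auto
  also have "\<dots> \<le> ?V powr (p - 1) * (?V powr (1 - p / q) * K powr p)"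
    using p assms by (intro mult_left_mono sum_cube_powr_le) auto
  \<comment> \<open>The volume exponents add up to
    \<open>(p - 1) + (1 - p / q) = p * (1 - 1 / q)\<close>, so taking the p-th root removes
    \<open>p\<close> from the bound.\<close>
  also have "\<dots> = (?V powr (1 - 1 / q) * K) powr p"
    using V assms(2) by (simp add: powr_mult powr_powr powr_add[symmetric] mult.assoc[symmetric] left_diff_distrib)
  finally have "?s \<le> ?V powr (1 - 1 / q) * K"
    using powr_less_mono2[of p "?V powr (1 - 1 / q) * K" ?s] p assms(2) by fastforce
  then have "?s / ?V \<le> ?V powr (1 - 1 / q) * K / ?V" using V by (intro divide_right_mono) auto
  also have "\<dots> = ?V powr (- 1 / q) * K"
    using V by (simp add: powr_diff powr_minus field_simps)
  finally show ?thesis by (simp add: cube_avg_def)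
qed

section \<open>The maximal function on the Morrey space\<close>

lemma maximal_function_le_max:
  fixes x :: "int ^ 'd \<Rightarrow> real"
  assumes "morrey_norm p q x \<le> ennreal K" and K: "0 \<le> K" and p: "1 \<le> p" and q: "0 < q"
  shows "\<exists>R\<le>N. maximal_function x k \<le> ennreal (max (cube_avg (\<lambda>j. \<bar>x j\<bar>) k R)
    (real (card (lattice_cube k N)) powr (- 1 / q) * K))"
proof -
  let ?a = "cube_avg (\<lambda>j. \<bar>x j\<bar>) k"
  \<comment> \<open>Only finitely many radii are at most \<open>N\<close>, so the best of them is
    attained; this \<open>R\<close> is the radius chosen at \<open>k\<close> for the linearised
    operator.\<close>
  have "Max (?a ` {..N}) \<in> ?a ` {..N}" by (intro Max_in) auto
  then obtain R where "R \<le> N" and "Max (?a ` {..N}) = ?a R" by (elim imageE) auto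
  then have R: "?a M \<le> ?a R" if "M \<le> N" for M
    using that Max_ge[of "?a ` {..N}" "?a M"] by auto
  have "?a M \<le> max (?a R) (real (card (lattice_cube k N)) powr (- 1 / q) * K)" for M
  proof (cases "M \<le> N")
    case True
    then show ?thesis using R by (simp add: le_max_iff_disj)
  next
    case False
    \<comment> \<open>The Morrey bound on averages decreases as the cube grows, so its value at
      radius \<open>N\<close> controls all larger radii.\<close>
    have "?a M \<le> real (card (lattice_cube k M)) powr (- 1 / q) * K"
      by (rule cube_avg_le_morrey[OF assms(1-3)])
    also have "\<dots> \<le> real (card (lattice_cube k N)) powr (- 1 / q) * K"
      using K q False card_lattice_cube_pos[of k N]
      by (intro mult_right_mono powr_mono2') (auto intro!: card_mono lattice_cube_mono finite_lattice_cube)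
    finally show ?thesis by simp
  qed
  then have "maximal_function x k \<le> ennreal (max (?a R) (real (card (lattice_cube k N)) powr (- 1 / q) * K))"
    unfolding maximal_function_eq_SUP_cube_avg by (intro SUP_least ennreal_leI)
  then show ?thesis using \<open>R \<le> N\<close> by blast
qed

text \<open>In the constant, \<open>4 ^ CARD('d)\<close> combines the \<open>2 ^ CARD('d)\<close> of
  the strong type estimate with the cost of passing from radius \<open>2 * N\<close> to
  \<open>N\<close>. The summand \<open>1\<close> comes from the large radii.\<close>

lemma morrey_norm_maximal_function_le:
  fixes x :: "int ^ 'd \<Rightarrow> real"
  assumes x: "morrey_norm p q x \<le> ennreal K" and K: "0 \<le> K" and p: "1 < p" "p \<le> q"
  shows "morrey_norm p q (\<lambda>m. enn2real (maximal_function x m))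
    \<le> ennreal ((4 ^ CARD('d) * 2 powr p * p / (p - 1) + 1) powr (1 / p) * K)"
  unfolding morrey_norm_def
proof (intro SUP_least, clarify)
  fix m :: "int ^ 'd" and N
  let ?S = "lattice_cube m N"
  let ?V = "real (card ?S)"
  let ?f = "\<lambda>j. \<bar>x j\<bar>"
  let ?A = "2 ^ CARD('d) * 2 powr p * p / (p - 1)"
  let ?C = "4 ^ CARD('d) * 2 powr p * p / (p - 1) + 1"
  have V: "0 < ?V" using card_lattice_cube_pos[of m N] by simp
  have C: "0 \<le> ?C" using p by simp
  \<comment> \<open>The volume of a cube depends only on its radius, so \<open>?V\<close> serves for
    every centre \<open>k\<close>.\<close>
  have "\<forall>k. \<exists>R. R \<le> N \<and>
      maximal_function x k \<le> ennreal (max (cube_avg ?f k R) (?V powr (- 1 / q) * K))"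
    using maximal_function_le_max[OF x K, of N] p by (simp add: card_lattice_cube)
  from choice[OF this] obtain r where *: "\<forall>k. r k \<le> N \<and>
      maximal_function x k \<le> ennreal (max (cube_avg ?f k (r k)) (?V powr (- 1 / q) * K))" ..
  have r: "r k \<le> N"
    and max: "maximal_function x k \<le> ennreal (max (cube_avg ?f k (r k)) (?V powr (- 1 / q) * K))" for k
    using *[rule_format, of k] by (rule conjunct1, rule conjunct2)
  have "\<bar>enn2real (maximal_function x k)\<bar> powr p \<le> cube_avg ?f k (r k) powr p + ?V powr (- p / q) * K powr p" for k
  proof -
    have "enn2real (maximal_function x k) \<le> max (cube_avg ?f k (r k)) (?V powr (- 1 / q) * K)"
      using K by (intro enn2real_leI max) (simp add: le_max_iff_disj)
    then have "\<bar>enn2real (maximal_function x k)\<bar> powr p \<le> max (cube_avg ?f k (r k)) (?V powr (- 1 / q) * K) powr p"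
      using p by (intro powr_mono2) auto
    also have "\<dots> \<le> cube_avg ?f k (r k) powr p + (?V powr (- 1 / q) * K) powr p"
      by (simp add: max_def)
    also have "(?V powr (- 1 / q) * K) powr p = ?V powr (- p / q) * K powr p"
      using K by (simp add: powr_mult powr_powr)
    finally show ?thesis .
  qed
  then have "(\<Sum>k\<in>?S. \<bar>enn2real (maximal_function x k)\<bar> powr p)
      \<le> (\<Sum>k\<in>?S. cube_avg ?f k (r k) powr p + ?V powr (- p / q) * K powr p)"
    by (intro sum_mono)
  also have "\<dots> = (\<Sum>k\<in>?S. cube_avg ?f k (r k) powr p) + ?V * ?V powr (- p / q) * K powr p"
    by (simp add: sum.distrib)
  \<comment> \<open>Summing a constant over the cube turns its decay into exactly the growth in
    \<open>?V\<close> that the Morrey norm allows.\<close>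
  also have "?V * ?V powr (- p / q) = ?V powr (1 - p / q)"
    using V by (simp add: powr_diff powr_minus field_simps)
  finally have 1: "(\<Sum>k\<in>?S. \<bar>enn2real (maximal_function x k)\<bar> powr p)
      \<le> (\<Sum>k\<in>?S. cube_avg ?f k (r k) powr p) + ?V powr (1 - p / q) * K powr p" .
  have 2: "(\<Sum>k\<in>?S. cube_avg ?f k (r k) powr p) \<le> ?A * (\<Sum>j\<in>lattice_cube m (2 * N). ?f j powr p)"
  proof (intro cube_avg_strong_type finite_lattice_cube)
    fix k assume k: "k \<in> ?S"
    show "lattice_cube k (r k) \<subseteq> lattice_cube m (2 * N)"
      using lattice_cube_trans[OF k] lattice_cube_mono[of "N + r k" "2 * N" m] r[of k] by fastforce
  qed (use p in auto)
  \<comment> \<open>As \<open>p <= q\<close>, the exponent \<open>1 - p / q\<close> lies between 0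
    and 1, so doubling the radius costs at most the factor \<open>2 ^ CARD('d)\<close>.\<close>
  have "real (card (lattice_cube m (2 * N))) powr (1 - p / q) \<le> (2 ^ CARD('d) * ?V) powr (1 - p / q)"
  proof (rule powr_mono2)
    show "real (card (lattice_cube m (2 * N))) \<le> 2 ^ CARD('d) * ?V"
      using of_nat_mono[OF card_lattice_cube_double[of m N], where 'a = real] by simp
  qed (use p in auto)
  also have "\<dots> = (2 ^ CARD('d)) powr (1 - p / q) * ?V powr (1 - p / q)"
    by (simp add: powr_mult)
  also have "\<dots> \<le> (2 ^ CARD('d)) powr 1 * ?V powr (1 - p / q)"
    using p by (intro mult_right_mono powr_mono) auto
  finally have "real (card (lattice_cube m (2 * N))) powr (1 - p / q) * K powr p
      \<le> 2 ^ CARD('d) * ?V powr (1 - p / q) * K powr p"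
    by (intro mult_right_mono) auto
  then have "(\<Sum>j\<in>lattice_cube m (2 * N). ?f j powr p) \<le> 2 ^ CARD('d) * ?V powr (1 - p / q) * K powr p"
    using sum_cube_powr_le[OF x K, of m "2 * N"] p by linarith
  then have "?A * (\<Sum>j\<in>lattice_cube m (2 * N). ?f j powr p)
      \<le> ?A * (2 ^ CARD('d) * ?V powr (1 - p / q) * K powr p)"
    using p by (intro mult_left_mono) auto
  with 1 2 have "(\<Sum>k\<in>?S. \<bar>enn2real (maximal_function x k)\<bar> powr p)
      \<le> ?A * (2 ^ CARD('d) * ?V powr (1 - p / q) * K powr p) + ?V powr (1 - p / q) * K powr p"
    by linarith
  also have "\<dots> = ?C * ?V powr (1 - p / q) * K powr p"
    using power_mult_distrib[of 2 "2 :: real" "CARD('d)"] by (simp add: distrib_right)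
  finally have "(\<Sum>k\<in>?S. \<bar>enn2real (maximal_function x k)\<bar> powr p) powr (1 / p)
      \<le> (?C * ?V powr (1 - p / q) * K powr p) powr (1 / p)"
    using p by (intro powr_mono2 sum_nonneg) auto
  also have "\<dots> = ?C powr (1 / p) * ?V powr (1 / p - 1 / q) * K"
    using p C K by (simp add: powr_mult powr_powr diff_divide_distrib)
  finally have "?V powr (1 / q - 1 / p) * (\<Sum>k\<in>?S. \<bar>enn2real (maximal_function x k)\<bar> powr p) powr (1 / p)
      \<le> ?V powr (1 / q - 1 / p) * (?C powr (1 / p) * ?V powr (1 / p - 1 / q) * K)"
    by (intro mult_left_mono) auto
  also have "\<dots> = (?V powr (1 / q - 1 / p) * ?V powr (1 / p - 1 / q)) * (?C powr (1 / p) * K)"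
    by (simp only: mult_ac)
  also have "?V powr (1 / q - 1 / p) * ?V powr (1 / p - 1 / q) = 1"
    using V by (simp add: powr_add[symmetric])
  finally show "ennreal (?V powr (1 / q - 1 / p) * (\<Sum>k\<in>?S. \<bar>enn2real (maximal_function x k)\<bar> powr p) powr (1 / p))
      \<le> ennreal (?C powr (1 / p) * K)"
    by (intro ennreal_leI) simp
qed

theorem theorem3p2:
  fixes p q :: real
  assumes "1 < p" and "p \<le> q"
  shows "(\<forall>x \<in> (morrey_space p q :: (int ^ 'd \<Rightarrow> real) set).
            (\<forall>m. maximal_function x m < \<infinity>) \<and>
            (\<lambda>m. enn2real (maximal_function x m)) \<in> morrey_space p q) \<and>
         (\<exists>C > (0::real). \<forall>x \<in> (morrey_space p q :: (int ^ 'd \<Rightarrow> real) set).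
            morrey_norm p q (\<lambda>m. enn2real (maximal_function x m)) \<le> ennreal C * morrey_norm p q x)"
proof -
  define C where "C = (4 ^ CARD('d) * 2 powr p * p / (p - 1) + 1) powr (1 / p)"
  have "0 < 4 ^ CARD('d) * 2 powr p * p / (p - 1) + 1"
    using assms by (intro add_nonneg_pos) auto
  then have C: "0 < C" by (simp add: C_def)
  have bound: "(\<forall>m. maximal_function x m < \<infinity>) \<and>
      morrey_norm p q (\<lambda>m. enn2real (maximal_function x m)) \<le> ennreal C * morrey_norm p q x \<and>
      (\<lambda>m. enn2real (maximal_function x m)) \<in> morrey_space p q"
    if "x \<in> morrey_space p q" for x :: "int ^ 'd \<Rightarrow> real"
  proof -
    define K where "K = enn2real (morrey_norm p q x)"
    have K: "0 \<le> K" and x: "morrey_norm p q x = ennreal K"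
      using that by (auto simp: K_def morrey_space_def)
    \<comment> \<open>Any radius would give a finite bound; \<open>0\<close> is taken. Finiteness
      ensures that \<open>enn2real\<close>, which sends infinity to \<open>0\<close>, loses
      nothing.\<close>
    have "maximal_function x m < \<infinity>" for m
      using maximal_function_le_max[of p q x K 0 m] x K assms by (auto elim: le_less_trans)
    moreover have "morrey_norm p q (\<lambda>m. enn2real (maximal_function x m)) \<le> ennreal (C * K)"
      unfolding C_def using K x assms by (intro morrey_norm_maximal_function_le) auto
    ultimately show ?thesis
      using x K C by (auto simp: ennreal_mult' morrey_space_def ennreal_mult_less_top elim!: le_less_trans)
  qed
  then show ?thesis using C by blast
qed

end
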